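(* Let $N\ge2$, $\alpha_N=1/N$ and $\pi\in(0,1)$. Let $X_1,\dots,X_N$ be i.i.d. $\mathrm{Unif}(0,1)$ and $T_1,\dots,T_N$ i.i.d. $\mathrm{Bernoulli}(\pi)$, independent of the $X_i$. Let $\mathcal N_i(X_{1:N})=\{\ell\ne i:X_\ell<X_i\}$, let the exposures be $$E_i=\sum_{\ell\ne i}(1-T_\ell)\mathbf 1\{X_\ell<X_i\},$$ and let the potential outcomes be $Y_i(0)=0$ and $Y_i(1)=X_i$ if $E_i=0$, $Y_i(1)=-1$ if $E_i\ge1$. Take $\mathcal Y=[-1,1]$ and the nonconformity score $S(x,e,y)=y$. Let $I\sim\mathrm{Unif}(\{1,\dots,N\})$ be independent of everything else. With $\tilde\Gamma_I^{\mathrm{WCP}}$ and $\Gamma_I^{\mathrm{IA-WCP}}$ the ideal WCP set and the IA-WCP set at miscoverage level $\alpha_N$ (defined in the context), $$\Pr\left[Y_I(1)\in\tilde\Gamma_I^{\mathrm{WCP}}\mid T_I=0\right]=\Pr\left[Y_I(1)\in\Gamma_I^{\mathrm{IA-WCP}}\mid T_I=0\right]=1-\frac{\pi^{N-1}}{N}\ \ge\ 1-\alpha_N .$$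
   Context: All definitions below are for $T_I=0$. $\mathcal I_1=\{j:T_j=1\}$. The weights are $W_j=(1-\pi)/\pi$ for all $j\in\mathcal I_1\cup\{I\}$. Observational scores: $V_j^{\mathrm{obs}}=S(X_j,E_j,Y_j(1))=Y_j(1)$ for $j\in\mathcal I_1$; candidate test score: $V_I(y)=S(X_I,E_I,y)=y$. Interventional quantities: let $\tilde T^I_{1:N}$ be $T_{1:N}$ with its $I$-th entry changed to $1$ and all others unchanged; $\tilde E_j^I=\sum_{\ell\ne j}(1-\tilde T^I_\ell)\mathbf 1\{X_\ell<X_j\}$; $\tilde Y_j^I(1)=X_j$ if $\tilde E_j^I=0$ and $-1$ if $\tilde E_j^I\ge1$; $V_j^{\mathrm{int}}=S(X_j,\tilde E_j^I,\tilde Y_j^I(1))=\tilde Y_j^I(1)$ for $j\in\mathcal I_1$; $V_I^{\mathrm{int}}(y)=S(X_I,\tilde E_I^I,y)=y$. Define $$p_{I,y}^{\mathrm{obs}}=\frac{W_I+\sum_{j\in\mathcal I_1}W_j\mathbf 1\{V_j^{\mathrm{obs}}\ge V_I(y)\}}{W_I+\sum_{j\in\mathcal I_1}W_j},\qquad p_{I,y}^{\mathrm{int}}=\frac{W_I+\sum_{j\in\mathcal I_1}W_j\mathbf 1\{V_j^{\mathrm{int}}\ge V_I^{\mathrm{int}}(y)\}}{W_I+\sum_{j\in\mathcal I_1}W_j},$$ $$\mathcal H_I=\{j\in\mathcal I_1:I\in\mathcal N_j(X_{1:N})\},\qquad \rho_{I,y}=\frac{\sum_{j\in\mathcal H_I}W_j\mathbf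 1\{V_j^{\mathrm{obs}}<V_I(y)\}}{W_I+\sum_{j\in\mathcal I_1}W_j}.$$ The ideal WCP set is $\tilde\Gamma_I^{\mathrm{WCP}}=\{y\in\mathcal Y:p_{I,y}^{\mathrm{int}}>\alpha_N\}$ and the IA-WCP set is $\Gamma_I^{\mathrm{IA-WCP}}=\{y\in\mathcal Y:p_{I,y}^{\mathrm{obs}}>(\alpha_N-\rho_{I,y})_+\}$, where $(x)_+=\max\{x,0\}$. *)

theory Defs
  imports "HOL-Probability.Probability"
begin

text \<open>
  The functions below act on a realisation: \<open>x\<close> and \<open>t\<close> are the realised covariates and treatments
  of the units \<open>1, \<dots>, N\<close> (\<open>True\<close> stands for treatment level 1), and \<open>i\<close> is the realised test
  unit.
\<close>

definition neighbours :: "nat \<Rightarrow> (nat \<Rightarrow> real) \<Rightarrow> nat \<Rightarrow> nat set" where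
  "neighbours N x j = {l \<in> {1..N}. l \<noteq> j \<and> x l < x j}"

definition exposure :: "nat \<Rightarrow> (nat \<Rightarrow> real) \<Rightarrow> (nat \<Rightarrow> bool) \<Rightarrow> nat \<Rightarrow> nat" where
  "exposure N x t j = (\<Sum>l\<in>{1..N} - {j}. (1 - of_bool (t l)) * of_bool (x l < x j))"

definition outcome :: "nat \<Rightarrow> (nat \<Rightarrow> real) \<Rightarrow> (nat \<Rightarrow> bool) \<Rightarrow> nat \<Rightarrow> bool \<Rightarrow> real" where
  "outcome N x t j a = (if a then (if exposure N x t j = 0 then x j else -1) else 0)"

definition outcome_space :: "real set" where
  "outcome_space = {-1..1}"

definition score :: "real \<Rightarrow> nat \<Rightarrow> real \<Rightarrow> real" where
  "score x e y = y"

definition treated :: "nat \<Rightarrow> (nat \<Rightarrow> bool) \<Rightarrow> nat set" where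
  "treated N t = {j \<in> {1..N}. t j}"

definition weight :: "real \<Rightarrow> nat \<Rightarrow> real" where
  "weight \<pi> j = (1 - \<pi>) / \<pi>"

text \<open>
  \<open>unit_score N x t j\<close> and \<open>cand_score N x t i y\<close> are the scores of a calibration unit and of the
  candidate value \<open>y\<close> under the treatment vector \<open>t\<close>. The observational scores use the realised
  treatments, the interventional ones use \<open>t(i := True)\<close>.
\<close>

definition unit_score :: "nat \<Rightarrow> (nat \<Rightarrow> real) \<Rightarrow> (nat \<Rightarrow> bool) \<Rightarrow> nat \<Rightarrow> real" where
  "unit_score N x t j = score (x j) (exposure N x t j) (outcome N x t j True)"

definition cand_score :: "nat \<Rightarrow> (nat \<Rightarrow> real) \<Rightarrow> (nat \<Rightarrow> bool) \<Rightarrow> nat \<Rightarrow> real \<Rightarrow> real" where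
  "cand_score N x t i y = score (x i) (exposure N x t i) y"

definition p_obs :: "nat \<Rightarrow> real \<Rightarrow> (nat \<Rightarrow> real) \<Rightarrow> (nat \<Rightarrow> bool) \<Rightarrow> nat \<Rightarrow> real \<Rightarrow> real" where
  "p_obs N \<pi> x t i y =
     (weight \<pi> i + (\<Sum>j\<in>treated N t. weight \<pi> j * of_bool (unit_score N x t j \<ge> cand_score N x t i y)))
     / (weight \<pi> i + (\<Sum>j\<in>treated N t. weight \<pi> j))"

text \<open>The calibration units remain those treated under \<open>t\<close>; only the scores are intervened on.\<close>

definition p_int :: "nat \<Rightarrow> real \<Rightarrow> (nat \<Rightarrow> real) \<Rightarrow> (nat \<Rightarrow> bool) \<Rightarrow> nat \<Rightarrow> real \<Rightarrow> real" where
  "p_int N \<pi> x t i y =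
     (weight \<pi> i + (\<Sum>j\<in>treated N t. weight \<pi> j *
        of_bool (unit_score N x (t(i := True)) j \<ge> cand_score N x (t(i := True)) i y)))
     / (weight \<pi> i + (\<Sum>j\<in>treated N t. weight \<pi> j))"

definition affected :: "nat \<Rightarrow> (nat \<Rightarrow> real) \<Rightarrow> (nat \<Rightarrow> bool) \<Rightarrow> nat \<Rightarrow> nat set" where
  "affected N x t i = {j \<in> treated N t. i \<in> neighbours N x j}"

definition rho :: "nat \<Rightarrow> real \<Rightarrow> (nat \<Rightarrow> real) \<Rightarrow> (nat \<Rightarrow> bool) \<Rightarrow> nat \<Rightarrow> real \<Rightarrow> real" where
  "rho N \<pi> x t i y =
     (\<Sum>j\<in>affected N x t i. weight \<pi> j * of_bool (unit_score N x t j < cand_score N x t i y))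
     / (weight \<pi> i + (\<Sum>j\<in>treated N t. weight \<pi> j))"

definition ideal_wcp_set ::
  "nat \<Rightarrow> real \<Rightarrow> real \<Rightarrow> (nat \<Rightarrow> real) \<Rightarrow> (nat \<Rightarrow> bool) \<Rightarrow> nat \<Rightarrow> real set" where
  "ideal_wcp_set N \<alpha> \<pi> x t i = {y \<in> outcome_space. p_int N \<pi> x t i y > \<alpha>}"

definition ia_wcp_set ::
  "nat \<Rightarrow> real \<Rightarrow> real \<Rightarrow> (nat \<Rightarrow> real) \<Rightarrow> (nat \<Rightarrow> bool) \<Rightarrow> nat \<Rightarrow> real set" where
  "ia_wcp_set N \<alpha> \<pi> x t i =
     {y \<in> outcome_space. p_obs N \<pi> x t i y > max (\<alpha> - rho N \<pi> x t i y) 0}"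

text \<open>
  The library's \<open>indep_var\<close> forces both random variables to have the same value type. This is the
  same notion for variables with values in different types.
\<close>

definition indep_rv ::
  "'a measure \<Rightarrow> 'b measure \<Rightarrow> ('a \<Rightarrow> 'b) \<Rightarrow> 'c measure \<Rightarrow> ('a \<Rightarrow> 'c) \<Rightarrow> bool" where
  "indep_rv M S U S' V \<longleftrightarrow>
     U \<in> measurable M S \<and> V \<in> measurable M S' \<and>
     prob_space.indep_set M {U -` A \<inter> space M | A. A \<in> sets S} {V -` B \<inter> space M | B. B \<in> sets S'}"

end

theory Submission
  imports Defs
begin

text \<open>
  Since all weights agree, the weighted p-values are \<open>(1 + k) / (1 + m)\<close> with counts \<open>k\<close> and
  \<open>m = card (treated N t) \<le> N - 1\<close>, and such a ratio exceeds \<open>1 / N\<close> unless \<open>k = 0\<close> and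
  \<open>m = N - 1\<close>. Hence, for both sets, coverage of an untreated test unit fails exactly if all other
  units are treated and the test unit has the strictly largest covariate. Given the test unit \<open>i\<close>,
  the treatment pattern has probability \<open>\<pi> ^ (N - 1) * (1 - \<pi>)\<close>; the probabilities that \<open>i\<close> has the
  strictly largest covariate add up to 1 over \<open>i\<close>, because ties have probability 0.
\<close>

section \<open>Weighted p-values as ratios of counts\<close>

lemma constant_weight_ratio:
  assumes "0 < \<pi>" "\<pi> < 1" "finite A"
  shows "(\<Sum>j\<in>A. weight \<pi> j * of_bool (P j)) / (weight \<pi> i + (\<Sum>j\<in>B. weight \<pi> j))
           = real (card {j \<in> A. P j}) / (1 + real (card B))"
    and "(weight \<pi> i + (\<Sum>j\<in>A. weight \<pi> j * of_bool (P j))) / (weight \<pi> i + (\<Sum>j\<in>B. weight \<pi> j))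
           = (1 + real (card {j \<in> A. P j})) / (1 + real (card B))"
proof -
  define w where "w = (1 - \<pi>) / \<pi>"
  have w: "w > 0" "weight \<pi> = (\<lambda>_. w)"
    using assms by (auto simp: w_def weight_def fun_eq_iff)
  have num: "(\<Sum>j\<in>A. w * of_bool (P j)) = w * real (card {j \<in> A. P j})"
    using assms by (simp add: Int_def flip: sum_distrib_left)
  have den: "w + (\<Sum>j\<in>B. w) = w * (1 + real (card B))"
    by (simp add: algebra_simps)
  show "(\<Sum>j\<in>A. weight \<pi> j * of_bool (P j)) / (weight \<pi> i + (\<Sum>j\<in>B. weight \<pi> j))
           = real (card {j \<in> A. P j}) / (1 + real (card B))"
    unfolding w num den using w(1) by simp
  have "w + w * real (card {j \<in> A. P j}) = w * (1 + real (card {j \<in> A. P j}))"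
    by (simp add: algebra_simps)
  then show "(weight \<pi> i + (\<Sum>j\<in>A. weight \<pi> j * of_bool (P j))) / (weight \<pi> i + (\<Sum>j\<in>B. weight \<pi> j))
           = (1 + real (card {j \<in> A. P j})) / (1 + real (card B))"
    unfolding w num den using w(1) by simp
qed

text \<open>Clearing denominators turns the comparison into \<open>m + 1 < (1 + k) * N\<close>. For
  \<open>k = 0\<close> this is \<open>m + 1 < N\<close>; for \<open>k > 0\<close> the right side is
  at least \<open>2 * N\<close>, which exceeds \<open>m + 1\<close> since 1 \<le>
  \<open>m + 1\<close> \<le> \<open>N\<close>. The assumption also forces \<open>N\<close> to be
  positive, so \<open>1 / real N\<close> is a genuine reciprocal.\<close>

lemma inverse_less_ratio_iff:
  fixes k m N :: nat
  assumes "m + 1 \<le> N"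
  shows "1 / real N < (1 + real k) / (1 + real m) \<longleftrightarrow> k > 0 \<or> m + 1 < N"
proof -
  have "1 / real N < (1 + real k) / (1 + real m) \<longleftrightarrow> real (m + 1) < real ((1 + k) * N)"
    using assms by (simp add: field_simps)
  also have "\<dots> \<longleftrightarrow> m + 1 < (1 + k) * N"
    by (simp only: of_nat_less_iff)
  also have "\<dots> \<longleftrightarrow> k > 0 \<or> m + 1 < N"
  proof (cases "k = 0")
    case False
    then have "2 * N \<le> (1 + k) * N"
      by (intro mult_le_mono1) simp
    then show ?thesis
      using False assms by linarith
  qed simp
  finally show ?thesis .
qed

text \<open>The treated units lie in a set of \<open>N - 1\<close> elements because \<open>i\<close>
  is untreated, and a subset of full cardinality is the whole set.\<close>

lemma card_treated_untreated:
  assumes "i \<in> {1..N}" "\<not> t i"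
  shows "card (treated N t) + 1 \<le> N"
    and "card (treated N t) + 1 < N \<longleftrightarrow> (\<exists>l\<in>{1..N} - {i}. \<not> t l)"
proof -
  have sub: "treated N t \<subseteq> {1..N} - {i}"
    using assms by (auto simp: treated_def)
  have card: "card ({1..N} - {i}) + 1 = N"
    using assms(1) by simp
  show le: "card (treated N t) + 1 \<le> N"
    using card_mono[OF _ sub] card by simp
  have "card (treated N t) + 1 = N \<longleftrightarrow> card (treated N t) = card ({1..N} - {i})"
    using card by linarith
  also have "\<dots> \<longleftrightarrow> treated N t = {1..N} - {i}"
    using card_subset_eq[OF _ sub] by (metis finite_Diff finite_atLeastAtMost)
  also have "\<dots> \<longleftrightarrow> (\<forall>l\<in>{1..N} - {i}. t l)"
    using assms by (auto simp: treated_def)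
  finally show "card (treated N t) + 1 < N \<longleftrightarrow> (\<exists>l\<in>{1..N} - {i}. \<not> t l)"
    using le by auto
qed

lemma card_filter_pos_iff:
  "finite A \<Longrightarrow> 0 < card {j \<in> A. P j} \<longleftrightarrow> (\<exists>j\<in>A. P j)"
  by (auto simp: card_gt_0_iff)

lemma less_p_int_iff:
  assumes "0 < \<pi>" "\<pi> < 1" "i \<in> {1..N}" "\<not> t i"
  shows "1 / real N < p_int N \<pi> x t i y \<longleftrightarrow>
    (\<exists>j\<in>treated N t. y \<le> unit_score N x (t(i := True)) j) \<or> (\<exists>l\<in>{1..N} - {i}. \<not> t l)"
proof -
  have fin: "finite (treated N t)"
    by (simp add: treated_def)
  define k where "k = card {j \<in> treated N t. y \<le> unit_score N x (t(i := True)) j}"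
  have "p_int N \<pi> x t i y = (1 + real k) / (1 + real (card (treated N t)))"
    unfolding p_int_def constant_weight_ratio(2)[OF assms(1,2) fin]
    by (simp add: k_def cand_score_def score_def)
  moreover have "k > 0 \<longleftrightarrow> (\<exists>j\<in>treated N t. y \<le> unit_score N x (t(i := True)) j)"
    unfolding k_def by (rule card_filter_pos_iff) (rule fin)
  ultimately show ?thesis
    using inverse_less_ratio_iff[OF card_treated_untreated(1)[of i N t, OF assms(3,4)], of k]
      card_treated_untreated(2)[of i N t, OF assms(3,4)]
    by simp
qed

text \<open>The observational p-value and \<open>rho\<close> share the denominator
  \<open>1 + m\<close>, so moving \<open>rho\<close> to the other side merges the two counts: the
  threshold lemma applies with \<open>k = c + h\<close>.\<close>

lemma less_p_obs_iff:
  assumes "0 < \<pi>" "\<pi> < 1" "i \<in> {1..N}" "\<not> t i"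
  shows "max (1 / real N - rho N \<pi> x t i y) 0 < p_obs N \<pi> x t i y \<longleftrightarrow>
    (\<exists>j\<in>treated N t. y \<le> unit_score N x t j) \<or> (\<exists>j\<in>affected N x t i. unit_score N x t j < y)
      \<or> (\<exists>l\<in>{1..N} - {i}. \<not> t l)"
proof -
  have fin: "finite (treated N t)" "finite (affected N x t i)"
    by (simp_all add: treated_def affected_def)
  define c where "c = card {j \<in> treated N t. y \<le> unit_score N x t j}"
  define h where "h = card {j \<in> affected N x t i. unit_score N x t j < y}"
  define m where "m = card (treated N t)"
  have p: "p_obs N \<pi> x t i y = (1 + real c) / (1 + real m)"
    unfolding p_obs_def constant_weight_ratio[OF assms(1,2) fin(1)]
    by (simp add: c_def m_def cand_score_def score_def)
  have r: "rho N \<pi> x t i y = real h / (1 + real m)"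
    unfolding rho_def constant_weight_ratio[OF assms(1,2) fin(2)]
    by (simp add: h_def m_def cand_score_def score_def)
  \<comment> \<open>The p-value is at least \<open>1 / (1 + m)\<close>, hence positive, so exceeding
    the maximum amounts to exceeding \<open>1 / real N - rho N \<pi> x t i y\<close>.\<close>
  have "max (1 / real N - rho N \<pi> x t i y) 0 < p_obs N \<pi> x t i y
      \<longleftrightarrow> 1 / real N < (1 + real c) / (1 + real m) + real h / (1 + real m)"
    unfolding p r by (auto simp: divide_pos_pos add_pos_nonneg)
  also have "\<dots> \<longleftrightarrow> 1 / real N < (1 + real (c + h)) / (1 + real m)"
    by (simp add: add_divide_distrib add.assoc)
  also have "\<dots> \<longleftrightarrow> c + h > 0 \<or> (\<exists>l\<in>{1..N} - {i}. \<not> t l)"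
    unfolding m_def inverse_less_ratio_iff[OF card_treated_untreated(1)[of i N t, OF assms(3,4)]]
      card_treated_untreated(2)[of i N t, OF assms(3,4)] ..
  also have "c + h > 0 \<longleftrightarrow> (\<exists>j\<in>treated N t. y \<le> unit_score N x t j)
      \<or> (\<exists>j\<in>affected N x t i. unit_score N x t j < y)"
    unfolding c_def h_def add_gr_0 card_filter_pos_iff[OF fin(1)] card_filter_pos_iff[OF fin(2)] ..
  finally show ?thesis
    by (simp only: disj_assoc)
qed

section \<open>Deterministic description of noncoverage\<close>

lemma exposure_eq_0_iff:
  "exposure N x t j = 0 \<longleftrightarrow> (\<forall>l\<in>{1..N} - {j}. x l < x j \<longrightarrow> t l)"
  by (auto simp: exposure_def)

text \<open>The noncoverage event for an untreated \<open>i\<close> whose outcome lies in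
  \<open>outcome_space\<close>. That \<open>i\<close> itself is untreated is stated separately,
  since it becomes the conditioning event.\<close>

definition sole_untreated_max :: "nat \<Rightarrow> (nat \<Rightarrow> real) \<Rightarrow> (nat \<Rightarrow> bool) \<Rightarrow> nat \<Rightarrow> bool" where
  "sole_untreated_max N x t i \<longleftrightarrow> (\<forall>l\<in>{1..N} - {i}. t l \<and> x l < x i)"

text \<open>Another untreated unit already pushes the p-value above the level. Otherwise
  \<open>t(i := True)\<close> treats everybody, all exposures vanish and every score is the
  covariate itself, so the p-value is large exactly if some other covariate is at least
  \<open>x i\<close>.\<close>

lemma outcome_mem_ideal_wcp_set_iff:
  assumes "0 < \<pi>" "\<pi> < 1" "i \<in> {1..N}" "\<not> t i"
  shows "outcome N x t i True \<in> ideal_wcp_set N (1 / real N) \<pi> x t i \<longleftrightarrow>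
    outcome N x t i True \<in> outcome_space \<and> \<not> sole_untreated_max N x t i"
proof (cases "\<forall>l\<in>{1..N} - {i}. t l")
  case True
  then have y: "outcome N x t i True = x i"
    by (simp add: outcome_def exposure_eq_0_iff)
  have v: "unit_score N x (t(i := True)) j = x j" for j
    using True by (simp add: unit_score_def score_def outcome_def exposure_eq_0_iff)
  show ?thesis
    unfolding ideal_wcp_set_def mem_Collect_eq less_p_int_iff[of \<pi> i N t, OF assms] y v sole_untreated_max_def
    using True assms(4) unfolding treated_def
    by (metis (no_types, lifting) Diff_iff mem_Collect_eq not_less singletonD)
next
  case False
  then show ?thesis
    unfolding ideal_wcp_set_def mem_Collect_eq less_p_int_iff[of \<pi> i N t, OF assms]
    by (auto simp: sole_untreated_max_def)
qed

text \<open>If \<open>i\<close> is the only untreated unit, it exposes exactly the units with a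
  larger covariate, and their observed scores drop to -1. The term \<open>rho\<close> restores what
  this drop removes from the p-value, which leads to the same condition as for the ideal
  set.\<close>

lemma outcome_mem_ia_wcp_set_iff:
  assumes "0 < \<pi>" "\<pi> < 1" "i \<in> {1..N}" "\<not> t i"
  shows "outcome N x t i True \<in> ia_wcp_set N (1 / real N) \<pi> x t i \<longleftrightarrow>
    outcome N x t i True \<in> outcome_space \<and> \<not> sole_untreated_max N x t i"
proof (cases "\<forall>l\<in>{1..N} - {i}. t l")
  case True
  then have y: "outcome N x t i True = x i"
    by (simp add: outcome_def exposure_eq_0_iff)
  have v: "unit_score N x t j = (if x i < x j then -1 else x j)" if "j \<in> treated N t" for j
    using True that assms(3,4)
    by (auto simp: unit_score_def score_def outcome_def exposure_eq_0_iff treated_def)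
  have A: "affected N x t i = {j \<in> treated N t. x i < x j}"
    using assms(3,4) by (auto simp: affected_def neighbours_def treated_def)
  \<comment> \<open>A unit with \<open>x i < x j\<close> has score -1: if -1 \<ge>
    \<open>x i\<close> it witnesses the first disjunct, otherwise the second. A unit with
    \<open>x j \<le> x i\<close> keeps its covariate as score and can witness only a tie.\<close>
  have "(\<exists>j\<in>treated N t. x i \<le> unit_score N x t j)
      \<or> (\<exists>j\<in>affected N x t i. unit_score N x t j < x i) \<longleftrightarrow> (\<exists>j\<in>treated N t. x i \<le> x j)"
    unfolding A using v by (smt (verit) mem_Collect_eq)
  also have "\<dots> \<longleftrightarrow> \<not> sole_untreated_max N x t i"
    using True assms(4) unfolding treated_def sole_untreated_max_def
    by (metis (no_types, lifting) Diff_iff mem_Collect_eq not_less singletonD)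
  finally show ?thesis
    unfolding ia_wcp_set_def mem_Collect_eq less_p_obs_iff[of \<pi> i N t, OF assms] y
    using True by blast
next
  case False
  then show ?thesis
    unfolding ia_wcp_set_def mem_Collect_eq less_p_obs_iff[of \<pi> i N t, OF assms]
    by (auto simp: sole_untreated_max_def)
qed

section \<open>Independence, ties and strict maxima of uniform variables\<close>

lemma (in prob_space) prob_indep_rv:
  assumes "indep_rv M S U S' V" "A \<in> sets S" "B \<in> sets S'"
  shows "\<P>(\<omega> in M. U \<omega> \<in> A \<and> V \<omega> \<in> B) = \<P>(\<omega> in M. U \<omega> \<in> A) * \<P>(\<omega> in M. V \<omega> \<in> B)"
proof -
  have "prob ((U -` A \<inter> space M) \<inter> (V -` B \<inter> space M))
      = prob (U -` A \<inter> space M) * prob (V -` B \<inter> space M)"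
    using assms unfolding indep_rv_def by (intro indep_setD) auto
  moreover have "(U -` A \<inter> space M) \<inter> (V -` B \<inter> space M) = {\<omega> \<in> space M. U \<omega> \<in> A \<and> V \<omega> \<in> B}"
    "U -` A \<inter> space M = {\<omega> \<in> space M. U \<omega> \<in> A}" "V -` B \<inter> space M = {\<omega> \<in> space M. V \<omega> \<in> B}"
    by auto
  ultimately show ?thesis
    by simp
qed

text \<open>By Fubini the diagonal is null for the product of the two laws, because the law of
  \<open>X k\<close> has no atoms; by independence that product is the joint law.\<close>

lemma (in prob_space) AE_uniform_no_ties:
  fixes X :: "'i \<Rightarrow> 'a \<Rightarrow> real"
  assumes indep: "indep_vars (\<lambda>_. borel) X J" and J: "j \<in> J" "k \<in> J" "j \<noteq> k"
    and unif: "distr M borel (X k) = uniform_measure lborel {0<..<1}"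
  shows "AE \<omega> in M. X j \<omega> \<noteq> X k \<omega>"
proof -
  have rv: "random_variable borel (X j)" "random_variable borel (X k)"
    using indep J by (auto simp: indep_vars_def)
  \<comment> \<open>Independence of the family is first restricted to the disjoint index sets
    \<open>{j}\<close> and \<open>{k}\<close>; evaluation at the single index then recovers the
    variables themselves.\<close>
  have iv: "indep_var borel (X j) borel (X k)"
    using indep_var_compose[OF indep_var_restrict[OF indep, of "{j}" "{k}"],
        of "\<lambda>f. f j" borel "\<lambda>f. f k" borel] J
    by (simp add: comp_def)
  interpret P: pair_sigma_finite "distr M borel (X j)" "distr M borel (X k)"
    using rv by (intro pair_sigma_finite.intro prob_space_imp_sigma_finite prob_space_distr)
  have null: "emeasure (distr M borel (X k)) {a} = 0" for a
  proof -
    have "emeasure lborel ({0<..<1} \<inter> {a}) = 0"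
      by (cases "a \<in> {0<..<1}") auto
    then show ?thesis
      by (simp add: unif)
  qed
  have "AE p in distr M borel (X j) \<Otimes>\<^sub>M distr M borel (X k). fst p \<noteq> snd p"
  proof (rule P.AE_pair_measure)
    show "{p \<in> space (distr M borel (X j) \<Otimes>\<^sub>M distr M borel (X k)). fst p \<noteq> snd p}
        \<in> sets (distr M borel (X j) \<Otimes>\<^sub>M distr M borel (X k))"
      by measurable
    have "AE b in distr M borel (X k). a \<noteq> b" for a
      by (rule AE_I[of _ _ "{a}"]) (auto simp: null)
    then show "AE a in distr M borel (X j). AE b in distr M borel (X k). fst (a, b) \<noteq> snd (a, b)"
      by simp
  qed
  moreover have "distr M borel (X j) \<Otimes>\<^sub>M distr M borel (X k)
      = distr M (borel \<Otimes>\<^sub>M borel) (\<lambda>\<omega>. (X j \<omega>, X k \<omega>))"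
    using iv by (simp add: indep_var_distribution_eq)
  ultimately have "AE p in distr M (borel \<Otimes>\<^sub>M borel) (\<lambda>\<omega>. (X j \<omega>, X k \<omega>)). fst p \<noteq> snd p"
    by metis
  moreover have "{p \<in> space (borel \<Otimes>\<^sub>M borel). fst p \<noteq> snd p} \<in> sets (borel \<Otimes>\<^sub>M (borel :: real measure))"
    by measurable
  moreover have "(\<lambda>\<omega>. (X j \<omega>, X k \<omega>)) \<in> M \<rightarrow>\<^sub>M borel \<Otimes>\<^sub>M borel"
    using rv by simp
  ultimately show ?thesis
    using AE_distr_iff[of "\<lambda>\<omega>. (X j \<omega>, X k \<omega>)" M "borel \<Otimes>\<^sub>M borel" "\<lambda>p. fst p \<noteq> snd p"] by simp
qed

lemma unique_argmax:
  fixes f :: "'i \<Rightarrow> 'b::linorder"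
  assumes "finite J" "J \<noteq> {}" "inj_on f J"
  shows "\<exists>!i. i \<in> J \<and> (\<forall>l\<in>J - {i}. f l < f i)"
proof -
  have "Max (f ` J) \<in> f ` J"
    using assms by (intro Max_in) auto
  then obtain i where i: "i \<in> J" "f i = Max (f ` J)"
    by auto
  then have "f l \<le> f i" if "l \<in> J" for l
    using that assms(1) by simp
  then have less: "f l < f i" if "l \<in> J - {i}" for l
    using that i(1) assms(3) by (auto simp: inj_on_def order_less_le)
  show ?thesis
  proof (rule ex1I[of _ i])
    fix k assume "k \<in> J \<and> (\<forall>l\<in>J - {k}. f l < f k)"
    with i(1) less[of k] show "k = i"
      using less_asym by blast
  qed (use i(1) less in blast)
qed

text \<open>The events are disjoint, since two strict maxima would each be below the other, and off
  the null set of ties some index attains the strict maximum. Working with the sum avoids an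
  exchangeability argument for each single probability; a uniform test unit calls for the sum
  alone.\<close>

lemma (in prob_space) sum_prob_strict_max:
  fixes X :: "'i \<Rightarrow> 'a \<Rightarrow> real"
  assumes J: "finite J" "J \<noteq> {}" and indep: "indep_vars (\<lambda>_. borel) X J"
    and unif: "\<And>j. j \<in> J \<Longrightarrow> distr M borel (X j) = uniform_measure lborel {0<..<1}"
  shows "(\<Sum>i\<in>J. \<P>(\<omega> in M. \<forall>l\<in>J - {i}. X l \<omega> < X i \<omega>)) = 1"
proof -
  have rv[measurable]: "random_variable borel (X j)" if "j \<in> J" for j
    using indep that by (auto simp: indep_vars_def)
  have ev: "{\<omega> \<in> space M. \<forall>l\<in>J - {i}. X l \<omega> < X i \<omega>} \<in> events" if [measurable]: "i \<in> J" for i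
  proof (intro sets.sets_Collect_finite_All)
    fix l assume "l \<in> J - {i}"
    then have [measurable]: "l \<in> J"
      by simp
    show "{\<omega> \<in> space M. X l \<omega> < X i \<omega>} \<in> events"
      by measurable
  qed (use J in simp)
  have "(\<Sum>i\<in>J. \<P>(\<omega> in M. \<forall>l\<in>J - {i}. X l \<omega> < X i \<omega>))
      = prob (\<Union>i\<in>J. {\<omega> \<in> space M. \<forall>l\<in>J - {i}. X l \<omega> < X i \<omega>})"
    using J ev by (intro finite_measure_finite_Union[symmetric])
      (auto simp: disjoint_family_on_def intro: less_asym')
  also have "\<dots> = 1"
  proof (rule prob_eq_1[THEN iffD2])
    show "(\<Union>i\<in>J. {\<omega> \<in> space M. \<forall>l\<in>J - {i}. X l \<omega> < X i \<omega>}) \<in> events"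
      using J ev by auto
    have "AE \<omega> in M. \<forall>j\<in>J. \<forall>k\<in>J. j \<noteq> k \<longrightarrow> X j \<omega> \<noteq> X k \<omega>"
      using J AE_uniform_no_ties[OF indep _ _ _ unif] by (auto simp: AE_finite_all)
    with AE_space show "AE \<omega> in M. \<omega> \<in> (\<Union>i\<in>J. {\<omega> \<in> space M. \<forall>l\<in>J - {i}. X l \<omega> < X i \<omega>})"
    proof eventually_elim
      case (elim \<omega>)
      then have "inj_on (\<lambda>j. X j \<omega>) J"
        by (auto simp: inj_on_def)
      with J unique_argmax[of J "\<lambda>j. X j \<omega>"] elim show ?case
        by blast
    qed
  qed
  finally show ?thesis .
qed

section \<open>Probability of a treatment pattern\<close>

lemma (in prob_space) prob_bernoulli:
  assumes "random_variable (count_space UNIV) B"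
    and "distr M (count_space UNIV) B = measure_pmf (bernoulli_pmf p)" "0 \<le> p" "p \<le> 1"
  shows "\<P>(\<omega> in M. B \<omega> = b) = (if b then p else 1 - p)"
proof -
  have "\<P>(\<omega> in M. B \<omega> = b) = measure (distr M (count_space UNIV) B) {b}"
    using assms(1) by (subst measure_distr) (auto intro!: arg_cong[where f = prob])
  also have "\<dots> = (if b then p else 1 - p)"
    using assms(3,4) by (simp add: assms(2) measure_pmf_single)
  finally show ?thesis .
qed

lemma (in prob_space) prob_only_untreated:
  assumes J: "finite J" "i \<in> J" and indep: "indep_vars (\<lambda>_. count_space UNIV) T J"
    and bern: "\<And>j. j \<in> J \<Longrightarrow> distr M (count_space UNIV) (T j) = measure_pmf (bernoulli_pmf p)"
    and p: "0 \<le> p" "p \<le> 1"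
  shows "\<P>(\<omega> in M. \<not> T i \<omega> \<and> (\<forall>l\<in>J - {i}. T l \<omega>)) = p ^ (card J - 1) * (1 - p)"
proof -
  have rv: "random_variable (count_space UNIV) (T j)" if "j \<in> J" for j
    using indep that by (auto simp: indep_vars_def)
  \<comment> \<open>The set \<open>{j \<noteq> i}\<close> is a singleton of a truth value: the
    pattern prescribes \<open>True\<close> for \<open>T j\<close> if \<open>j\<close> differs from
    \<open>i\<close> and \<open>False\<close> for \<open>T i\<close>. This makes the event one
    intersection over \<open>J\<close>.\<close>
  have "\<P>(\<omega> in M. \<not> T i \<omega> \<and> (\<forall>l\<in>J - {i}. T l \<omega>))
      = prob (\<Inter>j\<in>J. T j -` {j \<noteq> i} \<inter> space M)"
    using J by (intro arg_cong[where f = prob]) auto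
  also have "\<dots> = (\<Prod>j\<in>J. prob (T j -` {j \<noteq> i} \<inter> space M))"
    using J by (intro indep_varsD[OF indep]) auto
  also have "\<dots> = (\<Prod>j\<in>J. if j \<noteq> i then p else 1 - p)"
  proof (rule prod.cong)
    fix j assume j: "j \<in> J"
    have "T j -` {j \<noteq> i} \<inter> space M = {\<omega> \<in> space M. T j \<omega> = (j \<noteq> i)}"
      by auto
    then show "prob (T j -` {j \<noteq> i} \<inter> space M) = (if j \<noteq> i then p else 1 - p)"
      using prob_bernoulli[OF rv[OF j] bern[OF j] p] by simp
  qed simp
  also have "\<dots> = (1 - p) * (\<Prod>j\<in>J - {i}. p)"
    using J by (subst prod.remove[of _ i]) (auto intro!: prod.cong)
  finally show ?thesis
    using J by simp
qed

section \<open>The coverage probabilities\<close>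

theorem proposition1:
  fixes M :: "'a measure" and N :: nat and \<pi> \<alpha> :: real
    and X :: "nat \<Rightarrow> 'a \<Rightarrow> real" and T :: "nat \<Rightarrow> 'a \<Rightarrow> bool" and I :: "'a \<Rightarrow> nat"
  assumes M: "prob_space M"
    and N: "N \<ge> 2"
    and alpha: "\<alpha> = 1 / real N"
    and pi_range: "0 < \<pi>" "\<pi> < 1"
    and X_indep: "prob_space.indep_vars M (\<lambda>_. borel) X {1..N}"
    and X_unif: "\<And>j. j \<in> {1..N} \<Longrightarrow> distr M borel (X j) = uniform_measure lborel {0<..<1}"
    and T_indep: "prob_space.indep_vars M (\<lambda>_. count_space UNIV) T {1..N}"
    and T_bern: "\<And>j. j \<in> {1..N} \<Longrightarrow>
          distr M (count_space UNIV) (T j) = measure_pmf (bernoulli_pmf \<pi>)"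
    and XT_indep: "indep_rv M
          (Pi\<^sub>M {1..N} (\<lambda>_. borel)) (\<lambda>\<omega>. \<lambda>j\<in>{1..N}. X j \<omega>)
          (Pi\<^sub>M {1..N} (\<lambda>_. count_space UNIV)) (\<lambda>\<omega>. \<lambda>j\<in>{1..N}. T j \<omega>)"
    and I_unif: "distr M (count_space {1..N}) I = uniform_count_measure {1..N}"
    and I_indep: "indep_rv M
          (count_space {1..N}) I
          (Pi\<^sub>M {1..N} (\<lambda>_. borel) \<Otimes>\<^sub>M Pi\<^sub>M {1..N} (\<lambda>_. count_space UNIV))
          (\<lambda>\<omega>. ((\<lambda>j\<in>{1..N}. X j \<omega>), (\<lambda>j\<in>{1..N}. T j \<omega>)))"
  shows "\<P>(\<omega> in M. outcome N (\<lambda>j. X j \<omega>) (\<lambda>j. T j \<omega>) (I \<omega>) True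
              \<in> ideal_wcp_set N \<alpha> \<pi> (\<lambda>j. X j \<omega>) (\<lambda>j. T j \<omega>) (I \<omega>) \<bar> \<not> T (I \<omega>) \<omega>)
           = \<P>(\<omega> in M. outcome N (\<lambda>j. X j \<omega>) (\<lambda>j. T j \<omega>) (I \<omega>) True
              \<in> ia_wcp_set N \<alpha> \<pi> (\<lambda>j. X j \<omega>) (\<lambda>j. T j \<omega>) (I \<omega>) \<bar> \<not> T (I \<omega>) \<omega>)
       \<and> \<P>(\<omega> in M. outcome N (\<lambda>j. X j \<omega>) (\<lambda>j. T j \<omega>) (I \<omega>) True
              \<in> ia_wcp_set N \<alpha> \<pi> (\<lambda>j. X j \<omega>) (\<lambda>j. T j \<omega>) (I \<omega>) \<bar> \<not> T (I \<omega>) \<omega>)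
           = 1 - \<pi> ^ (N - 1) / real N
       \<and> 1 - \<pi> ^ (N - 1) / real N \<ge> 1 - \<alpha>"
proof -
  interpret prob_space M by (rule M)
  let ?J = "{1..N}"
  let ?MX = "Pi\<^sub>M ?J (\<lambda>_. borel :: real measure)"
  let ?MT = "Pi\<^sub>M ?J (\<lambda>_. count_space (UNIV :: bool set))"
  \<comment> \<open>The restrictions to the index set are points of the product spaces in which the
    independence assumptions are stated.\<close>
  define Xr where "Xr \<omega> = (\<lambda>j\<in>?J. X j \<omega>)" for \<omega>
  define Tr where "Tr \<omega> = (\<lambda>j\<in>?J. T j \<omega>)" for \<omega>
  define F where "F i \<omega> \<longleftrightarrow> sole_untreated_max N (\<lambda>j. X j \<omega>) (\<lambda>j. T j \<omega>) i" for i \<omega>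
  define Y where "Y \<omega> = outcome N (\<lambda>j. X j \<omega>) (\<lambda>j. T j \<omega>) (I \<omega>) True" for \<omega>
  have rvX[measurable]: "random_variable borel (X j)" if "j \<in> ?J" for j
    using X_indep that by (auto simp: indep_vars_def)
  have rvT[measurable]: "random_variable (count_space UNIV) (T j)" if "j \<in> ?J" for j
    using T_indep that by (auto simp: indep_vars_def)
  have rvI[measurable]: "I \<in> M \<rightarrow>\<^sub>M count_space ?J"
    using I_indep unfolding indep_rv_def by blast
  have I_range: "I \<omega> \<in> ?J" if "\<omega> \<in> space M" for \<omega>
    using measurable_space[OF rvI that] by simp
  \<comment> \<open>\<open>I\<close> takes values in \<open>{1..N}\<close> on all of
    \<open>space M\<close>, so an event evaluated at the random index is a finite disjoint union
    over its values. This yields its measurability as well as its probability.\<close>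
  have split_I: "\<P>(\<omega> in M. R (I \<omega>) \<omega>) = (\<Sum>i\<in>?J. \<P>(\<omega> in M. I \<omega> = i \<and> R i \<omega>))"
    and measurable_I: "{\<omega> \<in> space M. R (I \<omega>) \<omega>} \<in> events"
    if [measurable]: "\<And>i. i \<in> ?J \<Longrightarrow> Measurable.pred M (R i)" for R
  proof -
    have ev: "{\<omega> \<in> space M. I \<omega> = i \<and> R i \<omega>} \<in> events" if [measurable]: "i \<in> ?J" for i
      using that by measurable
    have eq: "{\<omega> \<in> space M. R (I \<omega>) \<omega>} = (\<Union>i\<in>?J. {\<omega> \<in> space M. I \<omega> = i \<and> R i \<omega>})"
      using I_range by auto
    show "\<P>(\<omega> in M. R (I \<omega>) \<omega>) = (\<Sum>i\<in>?J. \<P>(\<omega> in M. I \<omega> = i \<and> R i \<omega>))"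
      unfolding eq using ev
      by (intro finite_measure_finite_Union) (auto simp: disjoint_family_on_def)
    show "{\<omega> \<in> space M. R (I \<omega>) \<omega>} \<in> events"
      unfolding eq using ev by auto
  qed
  have prob_I: "\<P>(\<omega> in M. I \<omega> = i) = 1 / N" if "i \<in> ?J" for i
  proof -
    have "\<P>(\<omega> in M. I \<omega> = i) = measure (distr M (count_space ?J) I) {i}"
      using that by (subst measure_distr[OF rvI]) (auto intro!: arg_cong[where f = prob])
    then show ?thesis
      unfolding I_unif using that by (simp add: measure_uniform_count_measure)
  qed
  \<comment> \<open>Independence is used twice: \<open>I\<close> is split from the pair through the
    rectangle \<open>A \<times> B\<close>, then the covariates from the treatments.\<close>
  have prob_rect: "\<P>(\<omega> in M. I \<omega> = i \<and> Xr \<omega> \<in> A \<and> Tr \<omega> \<in> B)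
      = 1 / N * (\<P>(\<omega> in M. Xr \<omega> \<in> A) * \<P>(\<omega> in M. Tr \<omega> \<in> B))"
    if "i \<in> ?J" "A \<in> sets ?MX" "B \<in> sets ?MT" for i A B
    using prob_indep_rv[OF I_indep, of "{i}" "A \<times> B"] prob_indep_rv[OF XT_indep, of A B]
      that prob_I[OF that(1)]
    by (simp add: Xr_def Tr_def)

  have Q_i: "\<P>(\<omega> in M. I \<omega> = i \<and> \<not> T i \<omega>) = (1 - \<pi>) / N" if i: "i \<in> ?J" for i
  proof -
    have B: "{t \<in> space ?MT. \<not> t i} \<in> sets ?MT"
      using i by measurable
    have "\<P>(\<omega> in M. I \<omega> = i \<and> \<not> T i \<omega>)
        = \<P>(\<omega> in M. I \<omega> = i \<and> Xr \<omega> \<in> space ?MX \<and> Tr \<omega> \<in> {t \<in> space ?MT. \<not> t i})"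
      using i by (intro arg_cong[where f = prob]) (auto simp: Xr_def Tr_def space_PiM)
    also have "\<dots> = 1 / N * (prob (space M) * \<P>(\<omega> in M. T i \<omega> = False))"
      unfolding prob_rect[OF i sets.top B] using i
      by (intro arg_cong2[where f = "(*)"] arg_cong[where f = prob])
        (auto simp: Xr_def Tr_def space_PiM)
    also have "\<dots> = (1 - \<pi>) / N"
      using prob_bernoulli[OF rvT[OF i] T_bern[OF i], of False] pi_range by (simp add: prob_space)
    finally show ?thesis .
  qed
  have Q: "\<P>(\<omega> in M. \<not> T (I \<omega>) \<omega>) = 1 - \<pi>"
    using N by (subst split_I) (simp_all add: Q_i)

  have F_i: "\<P>(\<omega> in M. I \<omega> = i \<and> F i \<omega> \<and> \<not> T i \<omega>)
      = \<pi> ^ (N - 1) * (1 - \<pi>) / N * \<P>(\<omega> in M. \<forall>l\<in>?J - {i}. X l \<omega> < X i \<omega>)" if i: "i \<in> ?J" for i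
  proof -
    let ?A = "{x \<in> space ?MX. \<forall>l\<in>?J - {i}. x l < x i}"
    let ?B = "{t \<in> space ?MT. \<not> t i \<and> (\<forall>l\<in>?J - {i}. t l)}"
    have A: "?A \<in> sets ?MX"
      using i by measurable
    have B: "?B \<in> sets ?MT"
      using i by measurable
    \<comment> \<open>\<open>F i\<close> together with \<open>\<not> T i\<close> separates into a
      condition on the covariates and one on the treatments, hence is a rectangle.\<close>
    have "\<P>(\<omega> in M. I \<omega> = i \<and> F i \<omega> \<and> \<not> T i \<omega>) = \<P>(\<omega> in M. I \<omega> = i \<and> Xr \<omega> \<in> ?A \<and> Tr \<omega> \<in> ?B)"
      using i by (intro arg_cong[where f = prob])
        (auto simp: Xr_def Tr_def space_PiM F_def sole_untreated_max_def)
    also have "\<dots> = 1 / N * (\<P>(\<omega> in M. \<forall>l\<in>?J - {i}. X l \<omega> < X i \<omega>)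
        * \<P>(\<omega> in M. \<not> T i \<omega> \<and> (\<forall>l\<in>?J - {i}. T l \<omega>)))"
      unfolding prob_rect[OF i A B] using i
      by (intro arg_cong2[where f = "(*)"] arg_cong[where f = prob])
        (auto simp: Xr_def Tr_def space_PiM)
    finally show ?thesis
      using prob_only_untreated[OF _ i T_indep T_bern] pi_range by simp
  qed
  have pred_F: "Measurable.pred M (\<lambda>\<omega>. F i \<omega> \<and> \<not> T i \<omega>)" if "i \<in> ?J" for i
    using that unfolding F_def sole_untreated_max_def by measurable
  have F: "\<P>(\<omega> in M. F (I \<omega>) \<omega> \<and> \<not> T (I \<omega>) \<omega>) = \<pi> ^ (N - 1) * (1 - \<pi>) / N"
  proof -
    have "\<P>(\<omega> in M. F (I \<omega>) \<omega> \<and> \<not> T (I \<omega>) \<omega>) = (\<Sum>i\<in>?J. \<P>(\<omega> in M. I \<omega> = i \<and> F i \<omega> \<and> \<not> T i \<omega>))"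
      by (rule split_I) (rule pred_F)
    \<comment> \<open>The treatment factor is the same for every \<open>i\<close>, so only the sum
      of the strict-maximum probabilities is left.\<close>
    also have "\<dots> = \<pi> ^ (N - 1) * (1 - \<pi>) / N * (\<Sum>i\<in>?J. \<P>(\<omega> in M. \<forall>l\<in>?J - {i}. X l \<omega> < X i \<omega>))"
      by (simp add: F_i sum_distrib_left)
    also have "(\<Sum>i\<in>?J. \<P>(\<omega> in M. \<forall>l\<in>?J - {i}. X l \<omega> < X i \<omega>)) = 1"
      using N by (intro sum_prob_strict_max X_indep X_unif) auto
    finally show ?thesis by simp
  qed

  \<comment> \<open>The uniform law places covariates in the unit interval only almost surely, so
    membership of the outcome in \<open>outcome_space\<close> is an almost-sure statement
    too.\<close>
  have AE_Y: "AE \<omega> in M. Y \<omega> \<in> outcome_space"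
  proof -
    have "AE \<omega> in M. X j \<omega> \<in> {0<..<1}" if "j \<in> ?J" for j
    proof -
      have "AE x in distr M borel (X j). x \<in> {0<..<1}"
        unfolding X_unif[OF that] by (rule AE_uniform_measureI) auto
      then show ?thesis
        using that by (subst (asm) AE_distr_iff) auto
    qed
    then have "AE \<omega> in M. \<forall>j\<in>?J. X j \<omega> \<in> {0<..<1}"
      by (simp add: AE_finite_all)
    with AE_space show ?thesis
      by eventually_elim (use I_range in \<open>fastforce simp: Y_def outcome_def outcome_space_def\<close>)
  qed

  have cover: "\<P>(\<omega> in M. (Y \<omega> \<in> outcome_space \<and> \<not> F (I \<omega>) \<omega>) \<and> \<not> T (I \<omega>) \<omega>)
      = 1 - \<pi> - \<pi> ^ (N - 1) * (1 - \<pi>) / N"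
  proof -
    let ?Q = "{\<omega> \<in> space M. \<not> T (I \<omega>) \<omega>}" and ?F = "{\<omega> \<in> space M. F (I \<omega>) \<omega> \<and> \<not> T (I \<omega>) \<omega>}"
    have evQ: "?Q \<in> events"
      by (rule measurable_I[of "\<lambda>i \<omega>. \<not> T i \<omega>"]) measurable
    have evF: "?F \<in> events"
      by (rule measurable_I[of "\<lambda>i \<omega>. F i \<omega> \<and> \<not> T i \<omega>"]) (rule pred_F)
    have evC: "{\<omega> \<in> space M. (Y \<omega> \<in> outcome_space \<and> \<not> F (I \<omega>) \<omega>) \<and> \<not> T (I \<omega>) \<omega>} \<in> events"
      unfolding Y_def
    proof (rule measurable_I[of "\<lambda>i \<omega>. (outcome N (\<lambda>j. X j \<omega>) (\<lambda>j. T j \<omega>) i True \<in> outcome_space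
          \<and> \<not> F i \<omega>) \<and> \<not> T i \<omega>"])
      fix i assume [measurable]: "i \<in> ?J"
      show "Measurable.pred M (\<lambda>\<omega>. (outcome N (\<lambda>j. X j \<omega>) (\<lambda>j. T j \<omega>) i True \<in> outcome_space
          \<and> \<not> F i \<omega>) \<and> \<not> T i \<omega>)"
        unfolding outcome_def outcome_space_def F_def sole_untreated_max_def exposure_eq_0_iff if_True
        by measurable
    qed
    \<comment> \<open>Outside a null set the coverage event is the conditioning event minus the
      failure event contained in it.\<close>
    have "\<P>(\<omega> in M. (Y \<omega> \<in> outcome_space \<and> \<not> F (I \<omega>) \<omega>) \<and> \<not> T (I \<omega>) \<omega>) = prob (?Q - ?F)"
      using AE_Y evQ evF evC by (intro measure_eq_AE) auto
    also have "\<dots> = prob ?Q - prob ?F"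
      using evQ evF by (intro finite_measure_Diff) auto
    finally show ?thesis
      using Q F by simp
  qed

  \<comment> \<open>Coverage by either set, intersected with the conditioning event, is pointwise
    the same event; the two conditional probabilities therefore have the same numerator.\<close>
  have ideal: "{\<omega> \<in> space M. Y \<omega> \<in> ideal_wcp_set N \<alpha> \<pi> (\<lambda>j. X j \<omega>) (\<lambda>j. T j \<omega>) (I \<omega>) \<and> \<not> T (I \<omega>) \<omega>}
      = {\<omega> \<in> space M. (Y \<omega> \<in> outcome_space \<and> \<not> F (I \<omega>) \<omega>) \<and> \<not> T (I \<omega>) \<omega>}"
    using outcome_mem_ideal_wcp_set_iff[OF pi_range I_range]
    by (auto simp: alpha Y_def F_def)
  have ia: "{\<omega> \<in> space M. Y \<omega> \<in> ia_wcp_set N \<alpha> \<pi> (\<lambda>j. X j \<omega>) (\<lambda>j. T j \<omega>) (I \<omega>) \<and> \<not> T (I \<omega>) \<omega>}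
      = {\<omega> \<in> space M. (Y \<omega> \<in> outcome_space \<and> \<not> F (I \<omega>) \<omega>) \<and> \<not> T (I \<omega>) \<omega>}"
    using outcome_mem_ia_wcp_set_iff[OF pi_range I_range]
    by (auto simp: alpha Y_def F_def)
  have quot: "(1 - \<pi> - \<pi> ^ (N - 1) * (1 - \<pi>) / N) / (1 - \<pi>) = 1 - \<pi> ^ (N - 1) / N"
    using pi_range by (simp add: diff_divide_distrib)
  have "\<pi> ^ (N - 1) / N \<le> \<alpha>"
    using pi_range by (simp add: alpha divide_right_mono power_le_one)
  then show ?thesis
    unfolding cond_prob_def Y_def[symmetric] ideal ia cover Q quot by simp
qed

end
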